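(* Let $n\ge 1$ and let $\Omega=\bigcup_{j=1}^n[a_j,a_j+r_j)\subset\mathbb{R}$ with $r_j>0$, $\sum_{j=1}^n r_j=1$ and $a_j+r_j<a_{j+1}$ for $1\le j<n$. Suppose $\Omega$ is spectral and $\Lambda$ is a spectrum for $\Omega$ with $0\in\Lambda$. If for some $a,d\in\mathbb{R}$ with $d>0$ one has $a,\ a+d,\ \dots,\ a+(2n-1)d\in\Lambda$, then $a+d\mathbb{Z}\subseteq\Lambda$. Further, $d\in\mathbb{Z}$ and $\Omega$ $d$-tiles $\mathbb{R}$.
   Context: A set $\Lambda\subset\mathbb{R}$ is a spectrum for a measurable set $\Omega\subset\mathbb{R}$ of finite positive measure if the functions $e_\lambda(x)=|\Omega|^{-1/2}e^{2\pi i\lambda x}\chi_\Omega(x)$, $\lambda\in\Lambda$, form an orthonormal basis of $L^2(\Omega)$; $\Omega$ is spectral if it has a spectrum. For a positive integer $d$, "$\Omega$ $d$-tiles $\mathbb{R}$" means that $\sum_{k\in\mathbb{Z}}\chi_\Omega(x+k/d)=d$ for almost every $x\in\mathbb{R}$. *)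

theory Defs
  imports "HOL-Analysis.Analysis"
begin

text \<open>Elements of \<open>L\<^sup>2(M)\<close> are represented by functions rather than by their almost-everywhere
  equivalence classes; none of the notions below distinguishes functions that agree
  almost everywhere.\<close>

definition L2_space :: "'a measure \<Rightarrow> ('a \<Rightarrow> complex) set" where
  "L2_space M = {f \<in> borel_measurable M. integrable M (\<lambda>x. (cmod (f x))\<^sup>2)}"

definition L2_inner :: "'a measure \<Rightarrow> ('a \<Rightarrow> complex) \<Rightarrow> ('a \<Rightarrow> complex) \<Rightarrow> complex" where
  "L2_inner M f g = (LINT x|M. f x * cnj (g x))"

definition L2_norm :: "'a measure \<Rightarrow> ('a \<Rightarrow> complex) \<Rightarrow> real" where
  "L2_norm M f = sqrt (LINT x|M. (cmod (f x))\<^sup>2)"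

text \<open>A Hilbert space basis, given as an indexed family: an orthonormal family in \<open>L\<^sup>2(M)\<close>
  whose finite linear combinations are dense.\<close>

definition L2_orthonormal_basis :: "'a measure \<Rightarrow> ('i \<Rightarrow> 'a \<Rightarrow> complex) \<Rightarrow> 'i set \<Rightarrow> bool" where
  "L2_orthonormal_basis M e I \<longleftrightarrow>
     (\<forall>i\<in>I. e i \<in> L2_space M) \<and>
     (\<forall>i\<in>I. \<forall>j\<in>I. L2_inner M (e i) (e j) = (if i = j then 1 else 0)) \<and>
     (\<forall>f\<in>L2_space M. \<forall>\<epsilon>>0. \<exists>F c. finite F \<and> F \<subseteq> I \<and>
        L2_norm M (\<lambda>x. f x - (\<Sum>i\<in>F. c i * e i x)) < \<epsilon>)"

definition exp_fun :: "real set \<Rightarrow> real \<Rightarrow> real \<Rightarrow> complex" where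
  "exp_fun \<Omega> \<xi> x =
     of_real (measure lebesgue \<Omega> powr (-1/2)) * exp (2 * of_real pi * \<i> * of_real \<xi> * of_real x)
       * indicator \<Omega> x"

definition is_spectrum :: "real set \<Rightarrow> real set \<Rightarrow> bool" where
  "is_spectrum \<Lambda> \<Omega> \<longleftrightarrow>
     \<Omega> \<in> lmeasurable \<and> measure lebesgue \<Omega> > 0 \<and>
     L2_orthonormal_basis (lebesgue_on \<Omega>) (exp_fun \<Omega>) \<Lambda>"

definition spectral :: "real set \<Rightarrow> bool" where
  "spectral \<Omega> \<longleftrightarrow> (\<exists>\<Lambda>. is_spectrum \<Lambda> \<Omega>)"

definition d_tiles :: "nat \<Rightarrow> real set \<Rightarrow> bool" where
  "d_tiles d \<Omega> \<longleftrightarrow> d > 0 \<and>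
     (AE x in lebesgue.
        ((\<lambda>k::int. indicator \<Omega> (x + of_int k / real d) :: real) has_sum real d) UNIV)"

end

theory Submission imports Defs begin

text \<open>
  For \<open>\<mu> \<noteq> \<nu>\<close> the exponentials with frequencies \<open>\<mu>\<close> and \<open>\<nu>\<close> are orthogonal on \<open>\<Omega>\<close> exactly when
  \<open>t = \<mu> - \<nu>\<close> is a zero of
  \<open>Z t = (\<Sum>j=1..n. cis (2 * pi * t * (a j + r j)) - cis (2 * pi * t * a j))\<close>,
  since integrating over the intervals leaves only contributions of the \<open>2 n\<close> endpoints
  (\<open>exp_fun_orthogonal_iff\<close>).  Along an arithmetic progression \<open>t = t0 + k * d\<close> this is an exponential
  sum in \<open>k\<close>: fixed weights times the \<open>k\<close>-th powers of at most \<open>2 n\<close> distinct nodes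
  \<open>cis (2 * pi * d * p)\<close>, with \<open>p\<close> an endpoint.  By the invertibility of Vandermonde matrices,
  such a sum that vanishes for \<open>2 n\<close> consecutive \<open>k\<close> has total weight zero at each node, so it still
  vanishes when the power function is replaced by an arbitrary function of the node
  (\<open>weighted_difference_vanishes_of_power_sums\<close>).  Both conclusions come from a choice of that
  function.

  For \<open>\<nu> \<in> \<Lambda>\<close> and \<open>t0 = b - \<nu>\<close>, taking \<open>z \<mapsto> z powi m\<close> shows that \<open>b + d * m\<close> is orthogonal to
  \<open>\<nu>\<close> or equal to it, for every integer \<open>m\<close>. As a spectrum is a maximal orthogonal set
  (\<open>spectrum_maximal\<close>), \<open>b + d * m\<close> lies in \<open>\<Lambda>\<close>.

  For \<open>t0 = 0\<close> all weights are \<open>1\<close> or \<open>-1\<close>, so modulo \<open>1\<close> the numbers \<open>d * a j\<close> are a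
  rearrangement of the numbers \<open>d * (a j + r j)\<close>.  The number of integers \<open>k\<close> with
  \<open>x + k / d \<in> \<Omega>\<close> is a sum of differences of ceilings, and \<open>\<lceil>t\<rceil> - t\<close> depends only on \<open>t\<close> modulo
  \<open>1\<close>, so rounding cancels and the count is the total length times \<open>d\<close>, that is \<open>d\<close>, for every
  \<open>x\<close> (\<open>translate_count_eq\<close>).  Being a count, \<open>d\<close> is an integer, and the translates tile with
  multiplicity \<open>d\<close>.
\<close>

section \<open>Exponential sums with few nodes\<close>

text \<open>Linear combinations of the hypotheses replace the powers by any polynomial of degree less
  than \<open>card I\<close>. There are at most \<open>card I\<close> distinct nodes, so such a polynomial can vanish at all
  nodes but one; hence the weights at each single node add up to zero.\<close>

lemma weighted_sum_vanishes_of_power_sums: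
  fixes c x :: "'i \<Rightarrow> 'a::field" and h :: "'a \<Rightarrow> 'a"
  assumes fin: "finite I"
    and pow: "\<And>k. k < card I \<Longrightarrow> (\<Sum>i\<in>I. c i * x i ^ k) = 0"
  shows "(\<Sum>i\<in>I. c i * h (x i)) = 0"
proof -
  have poly0: "(\<Sum>i\<in>I. c i * poly p (x i)) = 0" if deg: "degree p < card I" for p
  proof -
    have "(\<Sum>i\<in>I. c i * poly p (x i))
        = (\<Sum>i\<in>I. \<Sum>k\<le>degree p. coeff p k * (c i * x i ^ k))"
      by (simp add: poly_altdef sum_distrib_left algebra_simps)
    also have "\<dots> = (\<Sum>k\<le>degree p. coeff p k * (\<Sum>i\<in>I. c i * x i ^ k))"
      by (subst sum.swap) (simp add: sum_distrib_left)
    also have "\<dots> = 0"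
      using deg by (intro sum.neutral ballI) (simp add: pow)
    finally show ?thesis .
  qed
  have group: "(\<Sum>i\<in>{i\<in>I. x i = v}. c i) = 0" if v: "v \<in> x ` I" for v
  proof -
    \<comment> \<open>\<open>p\<close> is, up to a factor, the Lagrange basis polynomial of the node \<open>v\<close>.\<close>
    define p where "p = (\<Prod>u\<in>x ` I - {v}. [:- u, 1:])"
    have fin': "finite (x ` I)" using fin by simp
    have "degree p = card (x ` I) - 1"
      unfolding p_def using v fin' by (subst degree_prod_eq_sum_degree) auto
    moreover have "0 < card (x ` I)" "card (x ` I) \<le> card I"
      using v fin' fin card_image_le by (auto simp: card_gt_0_iff)
    ultimately have "degree p < card I" by linarith
    then have "0 = (\<Sum>i\<in>I. c i * poly p (x i))"
      by (simp add: poly0)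
    also have "\<dots> = (\<Sum>i\<in>{i\<in>I. x i = v}. c i * poly p (x i))"
      by (intro sum.mono_neutral_right) (use fin in \<open>auto simp: p_def poly_prod\<close>)
    also have "\<dots> = (\<Sum>i\<in>{i\<in>I. x i = v}. c i) * poly p v"
      by (simp add: sum_distrib_right)
    finally show ?thesis
      using fin' by (simp add: p_def poly_prod)
  qed
  have "(\<Sum>i\<in>I. c i * h (x i)) = (\<Sum>v\<in>x ` I. \<Sum>i\<in>{i\<in>I. x i = v}. c i * h (x i))"
    by (rule sum.image_gen[OF fin])
  also have "\<dots> = (\<Sum>v\<in>x ` I. (\<Sum>i\<in>{i\<in>I. x i = v}. c i) * h v)"
    by (simp add: sum_distrib_right)
  also have "\<dots> = 0"
    by (simp add: group)
  finally show ?thesis .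
qed

text \<open>The same principle for two families of \<open>n\<close> nodes entering with opposite signs, which is the
  form in which the two ends of \<open>n\<close> intervals occur.\<close>

lemma weighted_difference_vanishes_of_power_sums:
  fixes u v x y :: "nat \<Rightarrow> 'a::field" and h :: "'a \<Rightarrow> 'a"
  assumes pow: "\<And>k. k < 2 * n \<Longrightarrow> (\<Sum>j=1..n. u j * x j ^ k - v j * y j ^ k) = 0"
  shows "(\<Sum>j=1..n. u j * h (x j) - v j * h (y j)) = 0"
proof -
  let ?I = "{1..n} \<times> (UNIV :: bool set)"
  define c where "c = (\<lambda>(j, s). if s then u j else - v j)"
  define z where "z = (\<lambda>(j, s). if s then x j else y j)"
  have split: "(\<Sum>i\<in>?I. c i * f (z i)) = (\<Sum>j=1..n. u j * f (x j) - v j * f (y j))" for f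
    by (simp add: sum.cartesian_product' UNIV_bool c_def z_def)
  have "(\<Sum>i\<in>?I. c i * h (z i)) = 0"
  proof (rule weighted_sum_vanishes_of_power_sums[where x = z and h = h])
    show "(\<Sum>i\<in>?I. c i * z i ^ k) = 0" if "k < card ?I" for k
      using pow[of k] that by (subst split) (simp add: card_cartesian_product)
  qed simp
  then show ?thesis by (simp only: split)
qed

section \<open>Exponentials on a set of finite measure\<close>

lemma exp_fun_mult_cnj:
  assumes "x \<in> \<Omega>"
  shows "exp_fun \<Omega> \<mu> x * cnj (exp_fun \<Omega> \<nu> x)
       = of_real (1 / measure lebesgue \<Omega>) * cis (2 * pi * (\<mu> - \<nu>) * x)"
proof -
  have "exp_fun \<Omega> \<xi> x = of_real (measure lebesgue \<Omega> powr (-1/2)) * cis (2 * pi * \<xi> * x)" for \<xi>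
    using assms by (simp add: exp_fun_def cis_conv_exp mult_ac)
  moreover have "measure lebesgue \<Omega> powr (-1/2) * measure lebesgue \<Omega> powr (-1/2)
      = 1 / measure lebesgue \<Omega>"
    by (simp add: powr_add[symmetric] powr_minus_divide)
  ultimately show ?thesis
    by (simp add: cis_cnj cis_mult algebra_simps flip: of_real_mult)
qed

lemma exp_fun_borel_measurable:
  "exp_fun \<Omega> \<xi> \<in> borel_measurable (lebesgue_on \<Omega>)"
proof -
  have "(\<lambda>x. of_real (measure lebesgue \<Omega> powr (-1/2))
            * exp (2 * of_real pi * \<i> * of_real \<xi> * of_real x) :: complex)
          \<in> borel_measurable borel"
    by (intro borel_measurable_continuous_onI continuous_intros)
  then have "(\<lambda>x. of_real (measure lebesgue \<Omega> powr (-1/2))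
            * exp (2 * of_real pi * \<i> * of_real \<xi> * of_real x) :: complex)
          \<in> borel_measurable (lebesgue_on \<Omega>)"
    by (intro measurable_restrict_space1 measurable_completion) simp
  then show ?thesis
    by (rule measurable_cong[THEN iffD1, rotated]) (simp add: exp_fun_def)
qed

lemma integrable_cis_lebesgue_on:
  assumes "\<Omega> \<in> lmeasurable"
  shows "integrable (lebesgue_on \<Omega>) (\<lambda>x. cis (t * x))"
proof (rule finite_measure.integrable_const_bound[where B = 1])
  show "finite_measure (lebesgue_on \<Omega>)"
    using assms by (rule finite_measure_lebesgue_on)
  have "(\<lambda>x. cis (t * x)) \<in> borel_measurable borel"
    by (intro borel_measurable_continuous_onI continuous_intros)
  then show "(\<lambda>x. cis (t * x)) \<in> borel_measurable (lebesgue_on \<Omega>)"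
    by (intro measurable_restrict_space1 measurable_completion) simp
qed simp

lemma L2_inner_exp_fun:
  assumes "\<Omega> \<in> lmeasurable"
  shows "integrable (lebesgue_on \<Omega>) (\<lambda>x. exp_fun \<Omega> \<mu> x * cnj (exp_fun \<Omega> \<nu> x))"
    and "L2_inner (lebesgue_on \<Omega>) (exp_fun \<Omega> \<mu>) (exp_fun \<Omega> \<nu>)
       = of_real (1 / measure lebesgue \<Omega>) * integral \<Omega> (\<lambda>x. cis (2 * pi * (\<mu> - \<nu>) * x))"
proof -
  have int: "integrable (lebesgue_on \<Omega>) (\<lambda>x. cis (2 * pi * (\<mu> - \<nu>) * x))"
    by (rule integrable_cis_lebesgue_on[OF assms])
  show "integrable (lebesgue_on \<Omega>) (\<lambda>x. exp_fun \<Omega> \<mu> x * cnj (exp_fun \<Omega> \<nu> x))"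
    by (rule Bochner_Integration.integrable_cong[THEN iffD2, OF refl exp_fun_mult_cnj])
      (use int in auto)
  have "L2_inner (lebesgue_on \<Omega>) (exp_fun \<Omega> \<mu>) (exp_fun \<Omega> \<nu>)
      = (LINT x|lebesgue_on \<Omega>. of_real (1 / measure lebesgue \<Omega>) * cis (2 * pi * (\<mu> - \<nu>) * x))"
    unfolding L2_inner_def by (intro Bochner_Integration.integral_cong refl exp_fun_mult_cnj) simp
  also have "\<dots> = of_real (1 / measure lebesgue \<Omega>)
      * (LINT x|lebesgue_on \<Omega>. cis (2 * pi * (\<mu> - \<nu>) * x))"
    by (rule integral_mult_right_zero)
  also have "(LINT x|lebesgue_on \<Omega>. cis (2 * pi * (\<mu> - \<nu>) * x))
      = integral \<Omega> (\<lambda>x. cis (2 * pi * (\<mu> - \<nu>) * x))"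
    by (rule lebesgue_integral_eq_integral[OF int]) (use assms in auto)
  finally show "L2_inner (lebesgue_on \<Omega>) (exp_fun \<Omega> \<mu>) (exp_fun \<Omega> \<nu>)
       = of_real (1 / measure lebesgue \<Omega>) * integral \<Omega> (\<lambda>x. cis (2 * pi * (\<mu> - \<nu>) * x))" .
qed

lemma L2_inner_exp_fun_self:
  assumes "\<Omega> \<in> lmeasurable" "measure lebesgue \<Omega> > 0"
  shows "L2_inner (lebesgue_on \<Omega>) (exp_fun \<Omega> \<mu>) (exp_fun \<Omega> \<mu>) = 1"
proof -
  have "((\<lambda>x. 1 :: real) has_integral measure lebesgue \<Omega>) \<Omega>"
    using assms(1) by (metis lmeasurable_iff_integrable_on lmeasure_integral integrable_integral)
  from has_integral_of_real[OF this, where 'b = complex]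
  have "integral \<Omega> (\<lambda>x. 1 :: complex) = of_real (measure lebesgue \<Omega>)"
    by (simp add: integral_unique)
  then show ?thesis
    using assms by (simp add: L2_inner_exp_fun(2))
qed

text \<open>If \<open>\<mu>\<close> were missing from \<open>\<Lambda>\<close>, then by Pythagoras \<open>e\<^sub>\<mu>\<close> would have distance at least
  \<open>\<parallel>e\<^sub>\<mu>\<parallel> = 1\<close> from all linear combinations of the basis functions, contradicting their density.\<close>

lemma spectrum_maximal:
  assumes spec: "is_spectrum \<Lambda> \<Omega>"
    and orth: "\<And>\<nu>. \<nu> \<in> \<Lambda> \<Longrightarrow> \<nu> \<noteq> \<mu> \<Longrightarrow>
      L2_inner (lebesgue_on \<Omega>) (exp_fun \<Omega> \<mu>) (exp_fun \<Omega> \<nu>) = 0"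
  shows "\<mu> \<in> \<Lambda>"
proof (rule ccontr)
  assume notin: "\<mu> \<notin> \<Lambda>"
  let ?M = "lebesgue_on \<Omega>" and ?e = "exp_fun \<Omega>"
  have meas: "\<Omega> \<in> lmeasurable" and pos: "measure lebesgue \<Omega> > 0"
    using spec by (auto simp: is_spectrum_def)
  note int = L2_inner_exp_fun(1)[OF meas]
  have sq: "complex_of_real ((cmod (?e \<mu> x))\<^sup>2) = ?e \<mu> x * cnj (?e \<mu> x)" for x
    by (rule complex_norm_square)
  have int_sq: "integrable ?M (\<lambda>x. (cmod (?e \<mu> x))\<^sup>2)"
    using int[of \<mu> \<mu>] unfolding sq[symmetric] complex_of_real_integrable_eq .
  have norm1: "(LINT x|?M. (cmod (?e \<mu> x))\<^sup>2) = 1"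
    using L2_inner_exp_fun_self[OF meas pos, of \<mu>]
    unfolding L2_inner_def sq[symmetric] integral_complex_of_real by (simp only: of_real_eq_1_iff)
  have "?e \<mu> \<in> L2_space ?M"
    using int_sq by (simp add: L2_space_def exp_fun_borel_measurable)
  then have "\<forall>\<epsilon>>0. \<exists>F c. finite F \<and> F \<subseteq> \<Lambda> \<and>
        L2_norm ?M (\<lambda>x. ?e \<mu> x - (\<Sum>i\<in>F. c i * ?e i x)) < \<epsilon>"
    using spec unfolding is_spectrum_def L2_orthonormal_basis_def by blast
  then obtain F c where F: "finite F" "F \<subseteq> \<Lambda>"
    and close: "L2_norm ?M (\<lambda>x. ?e \<mu> x - (\<Sum>i\<in>F. c i * ?e i x)) < 1"
    by (metis zero_less_one)
  define s where "s = (\<lambda>x. \<Sum>i\<in>F. c i * ?e i x)"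
  define R where "R = (\<lambda>x. Re (?e \<mu> x * cnj (s x)))"
  have cross: "?e \<mu> x * cnj (s x) = (\<Sum>i\<in>F. cnj (c i) * (?e \<mu> x * cnj (?e i x)))" for x
    by (simp add: s_def sum_distrib_left mult_ac)
  have cross_int: "integrable ?M (\<lambda>x. ?e \<mu> x * cnj (s x))"
    unfolding cross by (intro Bochner_Integration.integrable_sum integrable_mult_right int)
  have "(LINT x|?M. ?e \<mu> x * cnj (s x)) = 0"
  proof -
    have "(LINT x|?M. ?e \<mu> x * cnj (s x))
        = (\<Sum>i\<in>F. cnj (c i) * L2_inner ?M (?e \<mu>) (?e i))"
      unfolding cross L2_inner_def
      by (subst Bochner_Integration.integral_sum) (simp_all add: int)
    then show ?thesis using F orth notin by (force intro!: sum.neutral)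
  qed
  then have R: "integrable ?M R" "(LINT x|?M. R x) = 0"
    using cross_int integral_Re[OF cross_int] by (simp_all only: R_def integrable_Re zero_complex.sel)
  \<comment> \<open>Writing \<open>\<bar>s\<bar>\<^sup>2\<close> in terms of products of basis functions makes its integrability visible.\<close>
  have ss: "(cmod (s x))\<^sup>2 = Re (\<Sum>i\<in>F. \<Sum>j\<in>F. c i * cnj (c j) * (?e i x * cnj (?e j x)))" for x
  proof -
    have "complex_of_real ((cmod (s x))\<^sup>2) = s x * cnj (s x)"
      by (rule complex_norm_square)
    also have "\<dots> = (\<Sum>i\<in>F. \<Sum>j\<in>F. c i * cnj (c j) * (?e i x * cnj (?e j x)))"
      by (simp add: s_def sum_product mult_ac)
    finally show ?thesis by (metis Re_complex_of_real)
  qed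
  have ss_int: "integrable ?M (\<lambda>x. (cmod (s x))\<^sup>2)"
    unfolding ss by (intro integrable_Re Bochner_Integration.integrable_sum integrable_mult_right int)
  have expand: "(cmod (?e \<mu> x - s x))\<^sup>2 = (cmod (?e \<mu> x))\<^sup>2 - 2 * R x + (cmod (s x))\<^sup>2" for x
    unfolding cmod_power2 R_def by (simp add: power2_eq_square algebra_simps)
  have "(LINT x|?M. (cmod (?e \<mu> x - s x))\<^sup>2) = 1 + (LINT x|?M. (cmod (s x))\<^sup>2)"
    unfolding expand using int_sq ss_int R by (simp add: norm1)
  also have "\<dots> \<ge> 1"
    by simp
  finally have "L2_norm ?M (\<lambda>x. ?e \<mu> x - s x) \<ge> 1"
    by (simp add: L2_norm_def)
  with close show False by (simp add: s_def)
qed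

section \<open>Finite unions of separated intervals\<close>

lemma has_sum_sum:
  fixes f :: "'i \<Rightarrow> 'k \<Rightarrow> 'a::topological_comm_monoid_add"
  assumes "\<And>i. i \<in> I \<Longrightarrow> (f i has_sum s i) A"
  shows "((\<lambda>k. \<Sum>i\<in>I. f i k) has_sum (\<Sum>i\<in>I. s i)) A"
  using assms by (induction I rule: infinite_finite_induct) (auto intro: has_sum_add)

locale separated_intervals =
  fixes n :: nat and a r :: "nat \<Rightarrow> real" and \<Omega> :: "real set"
  assumes Omega: "\<Omega> = (\<Union>j\<in>{1..n}. {a j..<a j + r j})"
    and len_pos: "\<And>j. j \<in> {1..n} \<Longrightarrow> r j > 0"
    and sep: "\<And>j. 1 \<le> j \<Longrightarrow> j < n \<Longrightarrow> a j + r j < a (j + 1)"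
begin

lemma interval_before:
  assumes "1 \<le> i" "i < j" "j \<le> n"
  shows "a i + r i < a j"
  using assms(2,3)
proof (induction j rule: less_induct)
  case (less j)
  show ?case
  proof (cases "j = Suc i")
    case True
    then show ?thesis using sep[of i] less.prems assms(1) by simp
  next
    case False
    then obtain k where k: "j = Suc k" "i < k" using less.prems by (cases j) auto
    then have "a i + r i < a k" using less by auto
    also have "\<dots> < a k + r k" using len_pos[of k] k less.prems by simp
    also have "\<dots> < a j" using sep[of k] k less.prems by simp
    finally show ?thesis .
  qed
qed

lemma disjoint_intervals:
  assumes "i \<in> {1..n}" "j \<in> {1..n}" "i \<noteq> j"
  shows "{a i..<a i + r i} \<inter> {a j..<a j + r j} = {}"
  using assms interval_before[of i j] interval_before[of j i]
  by (cases i j rule: linorder_cases) auto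

lemma integral_cis:
  assumes "t \<noteq> 0"
  shows "integral \<Omega> (\<lambda>x. cis (2 * pi * t * x))
       = (\<Sum>j=1..n. cis (2 * pi * t * (a j + r j)) - cis (2 * pi * t * a j)) / (2 * pi * t * \<i>)"
proof -
  have one: "((\<lambda>x. cis (2 * pi * t * x)) has_integral
      (cis (2 * pi * t * (a j + r j)) - cis (2 * pi * t * a j)) / (2 * pi * t * \<i>))
      {a j..<a j + r j}" if "j \<in> {1..n}" for j
  proof -
    have closed: "((\<lambda>x. cis (2 * pi * t * x)) has_integral
      cis (2 * pi * t * (a j + r j)) / (2 * pi * t * \<i>) - cis (2 * pi * t * a j) / (2 * pi * t * \<i>))
      {a j..a j + r j}"
    proof (rule fundamental_theorem_of_calculus)
      show "a j \<le> a j + r j" using len_pos[OF that] by simp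
      show "((\<lambda>x. cis (2 * pi * t * x) / (2 * pi * t * \<i>)) has_vector_derivative
          cis (2 * pi * t * x)) (at x within {a j..a j + r j})" for x
      proof -
        have "((\<lambda>z. exp (2 * pi * t * \<i> * z) / (2 * pi * t * \<i>)) has_field_derivative
            exp (2 * pi * t * \<i> * of_real x)) (at (of_real x))"
          using assms by (auto intro!: derivative_eq_intros)
        from has_vector_derivative_real_field[OF this] show ?thesis
          by (simp add: cis_conv_exp mult_ac)
      qed
    qed
    have "sym_diff {a j..a j + r j} {a j..<a j + r j} \<subseteq> {a j + r j}" by auto
    then have "negligible (sym_diff {a j..a j + r j} {a j..<a j + r j})"
      using negligible_sing negligible_subset by blast
    then have "negligible {x \<in> {a j..a j + r j} - {a j..<a j + r j}. cis (2 * pi * t * x) \<noteq> 0}"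
      and "negligible {x \<in> {a j..<a j + r j} - {a j..a j + r j}. cis (2 * pi * t * x) \<noteq> 0}"
      by (auto elim!: negligible_subset)
    from has_integral_spike_set_eq[OF this] closed show ?thesis
      by (simp only: diff_divide_distrib)
  qed
  have "((\<lambda>x. cis (2 * pi * t * x)) has_integral
      (\<Sum>j=1..n. (cis (2 * pi * t * (a j + r j)) - cis (2 * pi * t * a j)) / (2 * pi * t * \<i>))) \<Omega>"
    unfolding Omega
  proof (rule has_integral_UN)
    show "pairwise (\<lambda>i j. negligible ({a i..<a i + r i} \<inter> {a j..<a j + r j})) {1..n}"
      unfolding pairwise_def using disjoint_intervals by (metis negligible_empty)
  qed (use one in auto)
  then show ?thesis
    by (simp add: integral_unique sum_divide_distrib)
qed

text \<open>Both the normalization and the factor \<open>1 / (2 * pi * t * \<i>)\<close> from integration are nonzero,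
  so only the endpoint sum decides.\<close>

lemma exp_fun_orthogonal_iff:
  assumes "\<Omega> \<in> lmeasurable" "measure lebesgue \<Omega> > 0" "\<mu> \<noteq> \<nu>"
  shows "L2_inner (lebesgue_on \<Omega>) (exp_fun \<Omega> \<mu>) (exp_fun \<Omega> \<nu>) = 0 \<longleftrightarrow>
    (\<Sum>j=1..n. cis (2 * pi * (\<mu> - \<nu>) * (a j + r j)) - cis (2 * pi * (\<mu> - \<nu>) * a j)) = 0"
  using assms by (simp add: L2_inner_exp_fun(2) integral_cis)

text \<open>For each interval the translates hitting it correspond to the integers in a half-open
  interval, which are counted by a difference of ceilings.\<close>

lemma has_sum_translates:
  fixes d x :: real
  assumes "d > 0"
  shows "((\<lambda>k::int. indicator \<Omega> (x + of_int k / d)) has_sum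
     (\<Sum>j=1..n. of_int \<lceil>d * (a j + r j - x)\<rceil> - of_int \<lceil>d * (a j - x)\<rceil> :: real)) UNIV"
proof -
  have one: "((\<lambda>k::int. indicator {a j..<a j + r j} (x + of_int k / d)) has_sum
     (of_int \<lceil>d * (a j + r j - x)\<rceil> - of_int \<lceil>d * (a j - x)\<rceil> :: real)) UNIV"
    if j: "j \<in> {1..n}" for j
  proof -
    define K where "K = {\<lceil>d * (a j - x)\<rceil>..<\<lceil>d * (a j + r j - x)\<rceil>}"
    have K: "x + of_int k / d \<in> {a j..<a j + r j} \<longleftrightarrow> k \<in> K" for k
    proof -
      have "a j \<le> x + of_int k / d \<longleftrightarrow> d * (a j - x) \<le> of_int k"
        using assms by (simp add: field_simps)
      moreover have "x + of_int k / d < a j + r j \<longleftrightarrow> of_int k < d * (a j + r j - x)"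
        using assms by (simp add: field_simps)
      ultimately show ?thesis
        by (simp add: K_def ceiling_le_iff less_ceiling_iff)
    qed
    have "\<lceil>d * (a j - x)\<rceil> \<le> \<lceil>d * (a j + r j - x)\<rceil>"
      using len_pos[OF j] assms by (intro ceiling_mono) simp
    then have card: "real (card K) = of_int \<lceil>d * (a j + r j - x)\<rceil> - of_int \<lceil>d * (a j - x)\<rceil>"
      by (simp add: K_def)
    have "((\<lambda>k::int. indicator {a j..<a j + r j} (x + of_int k / d) :: real) has_sum
        (\<Sum>k\<in>K. 1)) UNIV"
      by (rule has_sum_finite_neutralI[where B = K]) (use K in \<open>auto simp: K_def indicator_def\<close>)
    then show ?thesis by (simp add: card)
  qed
  have ind: "indicator \<Omega> y = (\<Sum>j=1..n. indicator {a j..<a j + r j} y :: real)" for y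
    unfolding Omega using disjoint_intervals
    by (intro indicator_UN_disjoint) (auto simp: disjoint_family_on_def)
  show ?thesis
    unfolding ind using one by (rule has_sum_sum)
qed

text \<open>The hypothesis says that the points \<open>cis (2 * pi * d * (a j + r j))\<close> and
  \<open>cis (2 * pi * d * a j)\<close> have equal power sums of all orders below \<open>2 * n\<close>, so any function of
  them has the same sum over both families. For fixed \<open>x\<close> the rounding error \<open>\<lceil>t\<rceil> - t\<close> at
  \<open>t = d * (p - x)\<close> is a function of \<open>cis (2 * pi * d * p)\<close>, and what remains of each difference of
  ceilings is the length \<open>d * r j\<close>.\<close>

lemma translate_count_eq:
  fixes d x :: real
  assumes pow: "\<And>k. k < 2 * n \<Longrightarrow>
      (\<Sum>j=1..n. cis (2 * pi * (real k * d) * (a j + r j)) - cis (2 * pi * (real k * d) * a j)) = 0"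
  shows "(\<Sum>j=1..n. of_int \<lceil>d * (a j + r j - x)\<rceil> - of_int \<lceil>d * (a j - x)\<rceil>) = d * (\<Sum>j=1..n. r j)"
proof -
  define g where "g t = of_int \<lceil>t - d * x\<rceil> - (t - d * x)" for t :: real
  \<comment> \<open>\<open>g\<close> has period \<open>1\<close>, so it factors through \<open>t \<mapsto> cis (2 * pi * t)\<close> as \<open>h\<close>.\<close>
  define h where "h z = complex_of_real (g (SOME t. cis (2 * pi * t) = z))" for z
  have h: "h (cis (2 * pi * t)) = of_real (g t)" for t
  proof -
    define t' where "t' = (SOME t'. cis (2 * pi * t') = cis (2 * pi * t))"
    have "cis (2 * pi * t') = cis (2 * pi * t)"
      unfolding t'_def by (rule someI[of _ t]) simp
    then obtain k :: int where "2 * pi * t' = 2 * pi * t + 2 * pi * k"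
      by (metis cis.sel sin_cos_eq_iff)
    then have "2 * pi * t' = 2 * pi * (t + k)"
      by (simp add: algebra_simps)
    then have "t' - d * x = t - d * x + of_int k" by simp
    then have "g t' = g t"
      unfolding g_def by (simp only: ceiling_add_of_int)
    then show ?thesis by (simp add: h_def t'_def)
  qed
  have "(\<Sum>j=1..n. 1 * h (cis (2 * pi * (d * (a j + r j)))) - 1 * h (cis (2 * pi * (d * a j)))) = 0"
  proof (rule weighted_difference_vanishes_of_power_sums[where h = h])
    fix k assume "k < 2 * n"
    have power: "1 * cis (2 * pi * (d * p)) ^ k = cis (2 * pi * (real k * d) * p)" for p
      unfolding Complex.DeMoivre mult_1_left by (rule arg_cong[where f = cis]) simp
    show "(\<Sum>j=1..n. 1 * cis (2 * pi * (d * (a j + r j))) ^ k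
        - 1 * cis (2 * pi * (d * a j)) ^ k) = 0"
      unfolding power using pow[OF \<open>k < 2 * n\<close>] .
  qed
  then have "complex_of_real (\<Sum>j=1..n. g (d * (a j + r j)) - g (d * a j)) = 0"
    by (simp add: h)
  then have "(\<Sum>j=1..n. g (d * (a j + r j)) - g (d * a j)) = 0"
    using of_real_eq_0_iff by blast
  moreover have "of_int \<lceil>d * (a j + r j - x)\<rceil> - of_int \<lceil>d * (a j - x)\<rceil>
      = g (d * (a j + r j)) - g (d * a j) + d * r j" for j
    by (simp add: g_def algebra_simps)
  ultimately show ?thesis
    by (simp add: sum.distrib sum_distrib_left)
qed

end

section \<open>Arithmetic progressions in a spectrum\<close>

theorem theorem4p3:
  fixes n :: nat and a r :: "nat \<Rightarrow> real" and \<Omega> \<Lambda> :: "real set" and b d :: real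
  assumes "n \<ge> 1"
    and "\<Omega> = (\<Union>j\<in>{1..n}. {a j..<a j + r j})"
    and "\<And>j. j \<in> {1..n} \<Longrightarrow> r j > 0"
    and "(\<Sum>j=1..n. r j) = 1"
    and "\<And>j. 1 \<le> j \<Longrightarrow> j < n \<Longrightarrow> a j + r j < a (j + 1)"
    and "spectral \<Omega>"
    and "is_spectrum \<Lambda> \<Omega>"
    and "0 \<in> \<Lambda>"
    and "d > 0"
    and "\<And>k::nat. k \<le> 2 * n - 1 \<Longrightarrow> b + real k * d \<in> \<Lambda>"
  shows "range (\<lambda>k::int. b + d * of_int k) \<subseteq> \<Lambda> \<and>
         d \<in> \<int> \<and>
         (\<exists>m::nat. d = real m \<and> d_tiles m \<Omega>)"
proof -
  interpret separated_intervals n a r \<Omega>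
    using assms(2,3,5) by unfold_locales
  define Z where "Z t = (\<Sum>j=1..n. cis (2 * pi * t * (a j + r j)) - cis (2 * pi * t * a j))" for t
  have meas: "\<Omega> \<in> lmeasurable" "measure lebesgue \<Omega> > 0"
    using assms(7) by (auto simp: is_spectrum_def)
  note orth_iff = exp_fun_orthogonal_iff[OF meas, folded Z_def]
  have Z_diff: "Z (\<mu> - \<nu>) = 0" if "\<mu> \<in> \<Lambda>" "\<nu> \<in> \<Lambda>" for \<mu> \<nu>
  proof (cases "\<mu> = \<nu>")
    case True
    then show ?thesis by (simp add: Z_def)
  next
    case False
    then show ?thesis
      using assms(7) that orth_iff[of \<mu> \<nu>]
      by (auto simp: is_spectrum_def L2_orthonormal_basis_def)
  qed
  have prog: "b + real k * d \<in> \<Lambda>" if "k < 2 * n" for k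
    using assms(10) that by simp
  have Z_all: "Z (b + d * of_int m - \<nu>) = 0" if \<nu>: "\<nu> \<in> \<Lambda>" for m :: int and \<nu>
  proof -
    have mult: "cis (2 * pi * (b - \<nu>) * p) * cis (2 * pi * (d * p)) powi l
        = cis (2 * pi * (b + d * of_int l - \<nu>) * p)" for p and l :: int
      by (simp add: cis_power_int cis_mult algebra_simps)
    have "(\<Sum>j=1..n.
        cis (2 * pi * (b - \<nu>) * (a j + r j)) * cis (2 * pi * (d * (a j + r j))) powi m
        - cis (2 * pi * (b - \<nu>) * a j) * cis (2 * pi * (d * a j)) powi m) = 0"
    proof (rule weighted_difference_vanishes_of_power_sums[where h = "\<lambda>z. z powi m"])
      fix k assume "k < 2 * n"
      then have "Z (b + d * of_int (int k) - \<nu>) = 0"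
        using Z_diff[OF prog \<nu>] by (simp add: mult.commute)
      then show "(\<Sum>j=1..n.
        cis (2 * pi * (b - \<nu>) * (a j + r j)) * cis (2 * pi * (d * (a j + r j))) ^ k
        - cis (2 * pi * (b - \<nu>) * a j) * cis (2 * pi * (d * a j)) ^ k) = 0"
        unfolding Z_def mult[symmetric] by simp
    qed
    then show ?thesis
      unfolding mult Z_def .
  qed
  have progression: "b + d * of_int m \<in> \<Lambda>" for m :: int
    using spectrum_maximal[OF assms(7)] orth_iff Z_all by metis
  have count: "(\<Sum>j=1..n. of_int \<lceil>d * (a j + r j - x)\<rceil> - of_int \<lceil>d * (a j - x)\<rceil>) = d" for x
  proof -
    have "Z (real k * d) = 0" if "k < 2 * n" for k
      using Z_diff[OF prog[OF that], of b] prog[of 0] assms(1) by simp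
    then show ?thesis
      using translate_count_eq[of d x] assms(4) by (simp add: Z_def)
  qed
  \<comment> \<open>The count at a single point already shows that \<open>d\<close> is an integer.\<close>
  have "d = of_int (\<Sum>j=1..n. \<lceil>d * (a j + r j - 0)\<rceil> - \<lceil>d * (a j - 0)\<rceil>)"
    using count[of 0] by simp
  then have d_int: "d \<in> \<int>" by (metis Ints_of_int)
  then obtain m :: nat where m: "d = real m"
    using assms(9) by (metis Ints_cases nonneg_int_cases of_int_0_le_iff less_imp_le of_int_of_nat_eq)
  have "d_tiles m \<Omega>"
    unfolding d_tiles_def
    using has_sum_translates[OF assms(9)] assms(9) m count by simp
  with d_int m progression show ?thesis
    by blast
qed

end
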